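(* Let $n$ be a positive integer, let $\mu=\{\mu_k\}_{k=0}^\infty$ be a sequence of complex numbers, and let $$\gamma_k=\sum_{j=0}^{\lfloor k/2\rfloor}\binom{k}{j}\mu_{k-2j},\qquad k\in\mathbb{N}.$$ For variables $\mathbf{z}=(z_1,\dots,z_n)$ let $e_k(\mathbf{z})$ denote the $k$-th elementary symmetric function (with $e_k=0$ for $k\notin\{0,\dots,n\}$), and set $$W_{\mu,n}(\mathbf{z})=\sum_{0\le i\le j\le n}\mu_{j-i}\,e_i(\mathbf{z})e_j(\mathbf{z}).$$ Then $$W_{\mu,n}(\mathbf{z})=e_n(\mathbf{z})\sum_{k=0}^n\gamma_k\, e_{n-k}\!\left(z_1+\tfrac{1}{z_1},\dots,z_n+\tfrac{1}{z_n}\right).$$ *)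

theory Defs
  imports Complex_Main
begin

(* The variables z_1, ..., z_n are the values z 1, ..., z n of a function z on nat. For k > n the
   index set below is empty, so elem_sym n k z = 0. *)
definition elem_sym :: "nat \<Rightarrow> nat \<Rightarrow> (nat \<Rightarrow> complex) \<Rightarrow> complex" where
  "elem_sym n k z = (\<Sum>S\<in>{S. S \<subseteq> {1..n} \<and> card S = k}. \<Prod>i\<in>S. z i)"

definition gamma_seq :: "(nat \<Rightarrow> complex) \<Rightarrow> nat \<Rightarrow> complex" where
  "gamma_seq \<mu> k = (\<Sum>j = 0..k div 2. of_nat (k choose j) * \<mu> (k - 2 * j))"

definition W_poly :: "(nat \<Rightarrow> complex) \<Rightarrow> nat \<Rightarrow> (nat \<Rightarrow> complex) \<Rightarrow> complex" where
  "W_poly \<mu> n z =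
     (\<Sum>(i, j)\<in>{(i, j). i \<le> j \<and> j \<le> n}. \<mu> (j - i) * elem_sym n i z * elem_sym n j z)"

end

(* The identity is a special case of one for two-sided sequences nu, where i and j range freely and
   gamma_k is the sum of binom(k, j) nu(k - 2j) over all j. That version goes by induction on n:
   adjoining a variable x multiplies by 1 + x^2 and adds x times the same expression for the
   sequence d |-> nu(d + 1) + nu(d - 1), and under this change of nu the sequence gamma is shifted
   by one, as Pascal's rule shows. The theorem is the case where nu extends mu by zero. *)
theory Submission
  imports Defs
begin

lemma elem_sym_eq_0: "n < k \<Longrightarrow> elem_sym n k z = 0"
proof -
  assume less: "n < k"
  have "card S \<noteq> k" if "S \<subseteq> {1..n}" for S :: "nat set"
    using card_mono[OF finite_atLeastAtMost that] less by simp
  then have "{S. S \<subseteq> {1..n} \<and> card S = k} = {}"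
    by blast
  then show ?thesis by (simp only: elem_sym_def sum.empty)
qed

lemma elem_sym_0_right [simp]: "elem_sym n 0 z = 1"
proof -
  \<comment> \<open>\<open>card\<close> is 0 on infinite sets too, so finiteness of the subsets of
    \<open>{1..n}\<close> has to be supplied.\<close>
  have "{S. S \<subseteq> {1..n} \<and> card S = 0} = {{}}"
    by (auto dest: finite_subset)
  then show ?thesis by (simp add: elem_sym_def)
qed

text \<open>Subsets of \<open>{1..Suc n}\<close> are sorted by whether they contain
  \<open>Suc n\<close>.\<close>

lemma elem_sym_Suc_Suc:
  "elem_sym (Suc n) (Suc k) z = elem_sym n (Suc k) z + z (Suc n) * elem_sym n k z"
proof -
  define A where "A m j = {S. S \<subseteq> {1..m} \<and> card S = j}" for m j :: nat
  have fin: "finite (A m j)" for m j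
    unfolding A_def by simp
  have finS: "finite S" and notin: "Suc n \<notin> S" if "S \<in> A n j" for S j
    using that by (auto simp: A_def intro: finite_subset)
  have split: "A (Suc n) (Suc k) = A n (Suc k) \<union> insert (Suc n) ` A n k"
  proof (intro equalityI subsetI)
    fix S assume S: "S \<in> A (Suc n) (Suc k)"
    show "S \<in> A n (Suc k) \<union> insert (Suc n) ` A n k"
    proof (cases "Suc n \<in> S")
      case True
      then have "S = insert (Suc n) (S - {Suc n})" "S - {Suc n} \<in> A n k"
        using S by (auto simp: A_def atLeastAtMostSuc_conv)
      then show ?thesis by blast
    next
      case False
      then show ?thesis using S by (auto simp: A_def atLeastAtMostSuc_conv)
    qed
  next
    fix S assume "S \<in> A n (Suc k) \<union> insert (Suc n) ` A n k"
    then show "S \<in> A (Suc n) (Suc k)"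
    proof
      assume "S \<in> insert (Suc n) ` A n k"
      then obtain T where T: "T \<in> A n k" "S = insert (Suc n) T" by blast
      then show ?thesis
        using finS[OF T(1)] notin[OF T(1)] by (auto simp: A_def)
    qed (auto simp: A_def)
  qed
  have inj: "inj_on (insert (Suc n)) (A n k)"
    by (rule inj_onI) (metis insert_ident notin)
  have "A n (Suc k) \<inter> insert (Suc n) ` A n k = {}"
    using notin by blast
  then have "(\<Sum>S\<in>A (Suc n) (Suc k). prod z S) =
      (\<Sum>S\<in>A n (Suc k). prod z S) + (\<Sum>S\<in>A n k. prod z (insert (Suc n) S))"
    by (simp add: split sum.union_disjoint fin sum.reindex[OF inj])
  also have "(\<Sum>S\<in>A n k. prod z (insert (Suc n) S)) = z (Suc n) * (\<Sum>S\<in>A n k. prod z S)"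
    unfolding sum_distrib_left by (intro sum.cong refl) (simp add: finS notin)
  finally show ?thesis by (simp add: elem_sym_def A_def)
qed

text \<open>This is E_{n+1}(t) = (1 + x t) E_n(t) with x = \<open>z (Suc n)\<close>, where E_n(t) is
  the product of the 1 + z_i t, under the linear map sending t^i to \<open>f i\<close>. As
  \<open>f\<close> is arbitrary, it serves for both indices of a double sum.\<close>

lemma sum_elem_sym_Suc:
  "(\<Sum>i\<le>Suc n. f i * elem_sym (Suc n) i z) =
    (\<Sum>i\<le>n. f i * elem_sym n i z) + z (Suc n) * (\<Sum>i\<le>n. f (Suc i) * elem_sym n i z)"
proof -
  have "(\<Sum>i\<le>Suc n. f i * elem_sym (Suc n) i z) =
      f 0 + (\<Sum>i\<le>n. f (Suc i) * elem_sym n (Suc i) z)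
        + z (Suc n) * (\<Sum>i\<le>n. f (Suc i) * elem_sym n i z)"
    unfolding sum.atMost_Suc_shift
    by (simp add: elem_sym_Suc_Suc sum.distrib sum_distrib_left algebra_simps)
  also have "f 0 + (\<Sum>i\<le>n. f (Suc i) * elem_sym n (Suc i) z) = (\<Sum>i\<le>Suc n. f i * elem_sym n i z)"
    unfolding sum.atMost_Suc_shift by simp
  also have "\<dots> = (\<Sum>i\<le>n. f i * elem_sym n i z)"
    by (simp add: elem_sym_eq_0)
  finally show ?thesis .
qed

text \<open>Pascal's rule, summed against an arbitrary \<open>f\<close>.\<close>

lemma sum_binomial_Suc:
  fixes f :: "nat \<Rightarrow> complex"
  shows "(\<Sum>j\<le>Suc k. of_nat (Suc k choose j) * f j) =
    (\<Sum>j\<le>k. of_nat (k choose j) * (f j + f (Suc j)))"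
proof -
  have "(\<Sum>j\<le>Suc k. of_nat (Suc k choose j) * f j) =
      f 0 + (\<Sum>j\<le>k. of_nat (k choose Suc j) * f (Suc j)) + (\<Sum>j\<le>k. of_nat (k choose j) * f (Suc j))"
    unfolding sum.atMost_Suc_shift by (simp add: sum.distrib algebra_simps)
  also have "f 0 + (\<Sum>j\<le>k. of_nat (k choose Suc j) * f (Suc j)) =
      (\<Sum>j\<le>Suc k. of_nat (k choose j) * f j)"
    unfolding sum.atMost_Suc_shift by simp
  finally show ?thesis by (simp add: sum.distrib algebra_simps)
qed

text \<open>Let L be the linear functional on Laurent polynomials with L(t^d) =
  \<open>\<nu> d\<close>. This is L((t + 1/t)^k).\<close>

definition two_sided_gamma :: "(int \<Rightarrow> complex) \<Rightarrow> nat \<Rightarrow> complex" where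
  "two_sided_gamma \<nu> k = (\<Sum>j\<le>k. of_nat (k choose j) * \<nu> (int k - 2 * int j))"

text \<open>In the same notation this is L(E_n(t) E_n(1/t)).\<close>

definition two_sided_W :: "(int \<Rightarrow> complex) \<Rightarrow> nat \<Rightarrow> (nat \<Rightarrow> complex) \<Rightarrow> complex" where
  "two_sided_W \<nu> n z =
     (\<Sum>i\<le>n. (\<Sum>j\<le>n. \<nu> (int j - int i) * elem_sym n j z) * elem_sym n i z)"

lemma two_sided_gamma_Suc:
  "two_sided_gamma \<nu> (Suc k) = two_sided_gamma (\<lambda>d. \<nu> (d + 1) + \<nu> (d - 1)) k"
  unfolding two_sided_gamma_def sum_binomial_Suc
  by (intro sum.cong refl) (simp add: algebra_simps)

text \<open>With x = \<open>z (Suc n)\<close>, the new factor is (1 + x t)(1 + x/t) = 1 + x^2 + x (t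
  + 1/t), and multiplication by t + 1/t inside L replaces \<nu> d by \<nu>(d + 1) + \<nu>(d -
  1).\<close>

lemma two_sided_W_Suc:
  "two_sided_W \<nu> (Suc n) z = (1 + z (Suc n) ^ 2) * two_sided_W \<nu> n z
    + z (Suc n) * two_sided_W (\<lambda>d. \<nu> (d + 1) + \<nu> (d - 1)) n z"
proof -
  define B where
    "B c = (\<Sum>i\<le>n. (\<Sum>j\<le>n. \<nu> (int j - int i + c) * elem_sym n j z) * elem_sym n i z)" for c
  have shift: "int (Suc j) - int (Suc i) = int j - int i" "int (Suc j) - int i = int j - int i + 1"
    "int j - int (Suc i) = int j - int i + -1" for i j
    by simp_all
  have "two_sided_W \<nu> (Suc n) z = (B 0 + z (Suc n) * B 1) + z (Suc n) * (B (-1) + z (Suc n) * B 0)"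
    \<comment> \<open>The double increment must be cancelled first, since the left sides of
      \<open>shift(2)\<close> and \<open>shift(3)\<close> match it as well.\<close>
    unfolding two_sided_W_def sum_elem_sym_Suc B_def shift(1)
    unfolding shift(2,3)
    by (simp only: distrib_right sum.distrib mult.assoc sum_distrib_left[symmetric] add_0_right)
  moreover have "two_sided_W (\<lambda>d. \<nu> (d + 1) + \<nu> (d - 1)) n z = B 1 + B (-1)"
    by (simp add: two_sided_W_def B_def distrib_right sum.distrib)
  moreover have "two_sided_W \<nu> n z = B 0"
    by (simp add: two_sided_W_def B_def)
  ultimately show ?thesis
    by (simp add: algebra_simps power2_eq_square)
qed

lemma two_sided_W_eq:
  assumes "\<And>i. i \<in> {1..n} \<Longrightarrow> z i \<noteq> 0"
  shows "two_sided_W \<nu> n z =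
    elem_sym n n z * (\<Sum>i\<le>n. two_sided_gamma \<nu> (n - i) * elem_sym n i (\<lambda>i. z i + 1 / z i))"
  using assms
proof (induction n arbitrary: \<nu>)
  case 0
  show ?case by (simp add: two_sided_W_def two_sided_gamma_def)
next
  case (Suc n)
  let ?w = "\<lambda>i. z i + 1 / z i" and ?x = "z (Suc n)"
  let ?\<nu>' = "\<lambda>d. \<nu> (d + 1) + \<nu> (d - 1)"
  let ?R = "\<lambda>\<nu>. \<Sum>i\<le>n. two_sided_gamma \<nu> (n - i) * elem_sym n i ?w"
  \<comment> \<open>The recursion involves both \<nu> and \<open>?\<nu>'\<close>, so the hypothesis
    is needed for every sequence.\<close>
  have IH: "two_sided_W \<nu> n z = elem_sym n n z * ?R \<nu>" for \<nu>
    using Suc by simp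
  \<comment> \<open>Here \<open>z (Suc n) \<noteq> 0\<close> enters: x (x + 1/x) is the factor 1 +
    x^2 of the recursion for \<open>two_sided_W\<close>.\<close>
  have x: "?x * ?w (Suc n) = 1 + ?x ^ 2"
    using Suc.prems[of "Suc n"] by (simp add: field_simps power2_eq_square)
  have top: "elem_sym (Suc n) (Suc n) z = ?x * elem_sym n n z"
    by (simp add: elem_sym_Suc_Suc elem_sym_eq_0)
  \<comment> \<open>For i \<le> n, \<open>Suc n - i\<close> is \<open>Suc (n - i)\<close>, so the
    first sum shifts gamma and yields \<open>?\<nu>'\<close>; in the second the two successors
    cancel and \<nu> stays.\<close>
  have "(\<Sum>i\<le>Suc n. two_sided_gamma \<nu> (Suc n - i) * elem_sym (Suc n) i ?w) =
      ?R ?\<nu>' + ?w (Suc n) * ?R \<nu>"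
    unfolding sum_elem_sym_Suc by (simp add: Suc_diff_le two_sided_gamma_Suc)
  then have "elem_sym (Suc n) (Suc n) z *
      (\<Sum>i\<le>Suc n. two_sided_gamma \<nu> (Suc n - i) * elem_sym (Suc n) i ?w) =
      ?x * (elem_sym n n z * ?R ?\<nu>') + (?x * ?w (Suc n)) * (elem_sym n n z * ?R \<nu>)"
    unfolding top by (simp only: ring_distribs mult_ac)
  then show ?case
    unfolding two_sided_W_Suc IH x by (simp only: add.commute)
qed

text \<open>The zeros at negative arguments remove exactly the terms with i > j from
  \<open>two_sided_W\<close> and those with 2j > k from \<open>two_sided_gamma\<close>.\<close>

definition extend_zero :: "(nat \<Rightarrow> complex) \<Rightarrow> int \<Rightarrow> complex" where
  "extend_zero \<mu> d = (if d \<ge> 0 then \<mu> (nat d) else 0)"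

lemma two_sided_gamma_extend_zero: "two_sided_gamma (extend_zero \<mu>) k = gamma_seq \<mu> k"
  unfolding two_sided_gamma_def gamma_seq_def
proof (rule sum.mono_neutral_cong_right)
  show "\<forall>j\<in>{..k} - {0..k div 2}. of_nat (k choose j) * extend_zero \<mu> (int k - 2 * int j) = 0"
  proof
    fix j assume "j \<in> {..k} - {0..k div 2}"
    then have "int k - 2 * int j < 0" by auto
    then show "of_nat (k choose j) * extend_zero \<mu> (int k - 2 * int j) = 0"
      by (simp add: extend_zero_def)
  qed
next
  fix j assume "j \<in> {0..k div 2}"
  \<comment> \<open>Since 2j \<le> k, the truncated subtraction on \<open>nat\<close> is
    exact.\<close>
  then have "int k - 2 * int j = int (k - 2 * j)" by auto
  then show "of_nat (k choose j) * extend_zero \<mu> (int k - 2 * int j) =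
      of_nat (k choose j) * \<mu> (k - 2 * j)"
    by (simp only: extend_zero_def of_nat_0_le_iff nat_int if_True)
qed auto

lemma two_sided_W_extend_zero: "two_sided_W (extend_zero \<mu>) n z = W_poly \<mu> n z"
proof -
  have "two_sided_W (extend_zero \<mu>) n z = (\<Sum>(i, j)\<in>{..n} \<times> {..n}.
      extend_zero \<mu> (int j - int i) * elem_sym n i z * elem_sym n j z)"
    unfolding two_sided_W_def sum.cartesian_product[symmetric]
    by (simp add: sum_distrib_left sum_distrib_right mult_ac)
  also have "\<dots> = W_poly \<mu> n z"
    unfolding W_poly_def
    by (rule sum.mono_neutral_cong_right) (auto simp: extend_zero_def nat_diff_distrib split: if_splits)
  finally show ?thesis .
qed

theorem theorem2p1:
  fixes n :: nat and \<mu> :: "nat \<Rightarrow> complex" and z :: "nat \<Rightarrow> complex"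
  assumes "n \<ge> 1"
    and "\<And>i. i \<in> {1..n} \<Longrightarrow> z i \<noteq> 0"
  shows "W_poly \<mu> n z =
    elem_sym n n z * (\<Sum>k = 0..n. gamma_seq \<mu> k * elem_sym n (n - k) (\<lambda>i. z i + 1 / z i))"
proof -
  let ?w = "\<lambda>i. z i + 1 / z i"
  have "W_poly \<mu> n z = elem_sym n n z * (\<Sum>i\<le>n. gamma_seq \<mu> (n - i) * elem_sym n i ?w)"
    using two_sided_W_eq[OF assms(2), where \<nu> = "extend_zero \<mu>"]
    by (simp add: two_sided_W_extend_zero two_sided_gamma_extend_zero)
  also have "(\<Sum>i\<le>n. gamma_seq \<mu> (n - i) * elem_sym n i ?w) =
      (\<Sum>k\<le>n. gamma_seq \<mu> k * elem_sym n (n - k) ?w)"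
    by (rule sum.reindex_bij_witness[of _ "\<lambda>k. n - k" "\<lambda>k. n - k"]) auto
  finally show ?thesis by (simp add: atLeast0AtMost)
qed

end
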